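(* Let $T>0$, let $\mu=f\pi_T$ be an ultra-log-concave probability measure on $\mathbb N$, and let $M:=\frac{f(1)}{f(0)}$. Then, for any probability measure $\nu$ on $\mathbb N$ which is absolutely continuous with respect to $\mu$ and has a finite first moment, $$\alpha_{TM}\big(W_{1,|\cdot|}(\nu,\mu)\big)\le H(\nu|\mu),$$ where, for $c>0$, $$\alpha_c(r):=c\left[\left(1+\frac rc\right)\log\left(1+\frac rc\right)-\frac rc\right].$$
   Context: $\mathbb N=\{0,1,2,\dots\}$. For $\lambda>0$, $\pi_\lambda(k)=e^{-\lambda}\lambda^k/k!$ is the Poisson measure on $\mathbb N$. A function $f:\mathbb N\to(0,\infty)$ is log-concave if $f(k)^2\ge f(k-1)f(k+1)$ for all integers $k\ge1$. A probability measure $\mu$ on $\mathbb N$ is ultra-log-concave if $\mu=f\pi_\lambda$ (i.e. $\mu(k)=f(k)\pi_\lambda(k)$ for all $k$) for some $\lambda>0$ and some positive log-concave $f$; this is equivalent to the same property holding for every $\lambda>0$. Writing $\mu=f\pi_T$ means $f:\mathbb N\to(0,\infty)$ is the (log-concave) density of $\mu$ with respect to $\pi_T$. The Wasserstein 1-distance between probability measures $\nu,\rho$ on $\mathbb N$ with finite first moments is $W_{1,|\cdot|}(\nu,\rho):=\inf_\Pi\int_{\mathbb N\times\mathbb N}|x-y|\,d\Pi(x,y)$, the infimum being over all couplings $\Pi$ of $(\nu,\rho)$. The relative entropy is $H(\nu|\mu):=\int\log\left(\frac{d\nu}{d\mu}\right)d\nu$. *)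

theory Defs
  imports "HOL-Probability.Probability"
begin

text \<open>Probability measures on \<open>\<nat>\<close> are elements of \<^typ>\<open>nat pmf\<close>.\<close>

definition log_concave_seq :: "(nat \<Rightarrow> real) \<Rightarrow> bool" where
  "log_concave_seq f \<longleftrightarrow>
     (\<forall>k. f k > 0) \<and> (\<forall>k\<ge>1. (f k)\<^sup>2 \<ge> f (k - 1) * f (k + 1))"

definition has_poisson_density :: "nat pmf \<Rightarrow> (nat \<Rightarrow> real) \<Rightarrow> real \<Rightarrow> bool" where
  "has_poisson_density \<mu> f l \<longleftrightarrow>
     (\<forall>k. f k > 0) \<and> (\<forall>k. pmf \<mu> k = f k * pmf (poisson_pmf l) k)"

definition ultra_log_concave :: "nat pmf \<Rightarrow> bool" where
  "ultra_log_concave \<mu> \<longleftrightarrow>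
     (\<exists>l>0. \<exists>f. log_concave_seq f \<and> has_poisson_density \<mu> f l)"

definition finite_first_moment :: "nat pmf \<Rightarrow> bool" where
  "finite_first_moment \<nu> \<longleftrightarrow> integrable (measure_pmf \<nu>) real"

definition couplings :: "'a pmf \<Rightarrow> 'b pmf \<Rightarrow> ('a \<times> 'b) pmf set" where
  "couplings \<nu> \<rho> = {\<pi>. map_pmf fst \<pi> = \<nu> \<and> map_pmf snd \<pi> = \<rho>}"

text \<open>
  The transport cost is valued in \<^typ>\<open>ennreal\<close>, so that a coupling of infinite cost really
  has cost \<open>\<infinity>\<close>. It is finite whenever both measures have finite first moment
  (lemma \<open>W1_finite\<close> below); ultra-log-concave measures always do, their mass at \<open>k\<close> being
  bounded by a constant times \<open>c\<^sup>k / k!\<close>.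
\<close>

definition W1 :: "nat pmf \<Rightarrow> nat pmf \<Rightarrow> ennreal" where
  "W1 \<nu> \<rho> = (INF \<pi>\<in>couplings \<nu> \<rho>. \<integral>\<^sup>+(x, y). ennreal \<bar>real x - real y\<bar> \<partial>measure_pmf \<pi>)"

text \<open>
  \<^const>\<open>KL_divergence\<close> is a Bochner integral and hence \<open>0\<close> when \<open>log (d\<nu>/d\<mu>)\<close> is not
  \<open>\<nu>\<close>-integrable, where the relative entropy is \<open>\<infinity>\<close>. We therefore integrate the
  library's entropy density (natural logarithm) as an extended real, positive part minus
  negative part; the integral of the negative part is finite whenever \<open>\<nu>\<close> is a probability
  measure absolutely continuous with respect to the probability measure \<open>\<mu>\<close>. Beware that
  \<^const>\<open>entropy_density\<close> takes the reference measure first.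
\<close>

definition rel_entropy :: "'a measure \<Rightarrow> 'a measure \<Rightarrow> ereal" where
  "rel_entropy \<nu> \<mu> =
     enn2ereal (\<integral>\<^sup>+x. ennreal (entropy_density (exp 1) \<mu> \<nu> x) \<partial>\<nu>) -
     enn2ereal (\<integral>\<^sup>+x. ennreal (- entropy_density (exp 1) \<mu> \<nu> x) \<partial>\<nu>)"

definition alpha :: "real \<Rightarrow> real \<Rightarrow> real" where
  "alpha c r = c * ((1 + r / c) * ln (1 + r / c) - r / c)"

lemma rel_entropy_eq_KL_divergence:
  assumes "integrable \<nu> (entropy_density (exp 1) \<mu> \<nu>)"
  shows "rel_entropy \<nu> \<mu> = ereal (KL_divergence (exp 1) \<mu> \<nu>)"
proof -
  let ?g = "entropy_density (exp 1) \<mu> \<nu>"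
  let ?p = "\<integral>\<^sup>+x. ennreal (?g x) \<partial>\<nu>" and ?n = "\<integral>\<^sup>+x. ennreal (- ?g x) \<partial>\<nu>"
  have "?p \<noteq> \<infinity>" "?n \<noteq> \<infinity>"
    using assms by (auto simp: real_integrable_def)
  then have "enn2ereal ?p = ereal (enn2real ?p)" "enn2ereal ?n = ereal (enn2real ?n)"
    by (metis enn2ereal_ennreal enn2real_nonneg ennreal_enn2real_if infinity_ennreal_def)+
  then show ?thesis
    by (simp add: rel_entropy_def KL_divergence_def real_lebesgue_integral_def[OF assms])
qed

lemma W1_finite:
  assumes "finite_first_moment \<nu>" "finite_first_moment \<rho>"
  shows "W1 \<nu> \<rho> < \<infinity>"
proof -
  have fin: "(\<integral>\<^sup>+x. ennreal (real x) \<partial>measure_pmf p) < \<infinity>" if "finite_first_moment p" for p :: "nat pmf"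
    using that by (auto simp: finite_first_moment_def real_integrable_def less_top)
  have "W1 \<nu> \<rho> \<le> (\<integral>\<^sup>+(x, y). ennreal \<bar>real x - real y\<bar> \<partial>measure_pmf (pair_pmf \<nu> \<rho>))"
    unfolding W1_def
    by (rule INF_lower) (simp add: couplings_def map_fst_pair_pmf map_snd_pair_pmf)
  also have "\<dots> \<le> (\<integral>\<^sup>+z. ennreal (real (fst z)) + ennreal (real (snd z)) \<partial>measure_pmf (pair_pmf \<nu> \<rho>))"
    by (intro nn_integral_mono) (auto simp flip: ennreal_plus intro!: ennreal_leI)
  also have "\<dots> = (\<integral>\<^sup>+x. ennreal (real x) \<partial>measure_pmf (map_pmf fst (pair_pmf \<nu> \<rho>))) +
      (\<integral>\<^sup>+x. ennreal (real x) \<partial>measure_pmf (map_pmf snd (pair_pmf \<nu> \<rho>)))"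
    by (subst nn_integral_add) auto
  also have "\<dots> < \<infinity>"
    using fin[OF assms(1)] fin[OF assms(2)] by (simp add: map_fst_pair_pmf map_snd_pair_pmf)
  finally show ?thesis .
qed

end

theory Submission
  imports Defs
begin

text \<open>
  Ultra-log-concavity says that \<open>\<mu>\<close> is reversible for a birth-death chain with death rate
  \<open>k\<close> and nonincreasing birth rate; the rate at \<open>0\<close> is \<open>c = T M\<close>. The solution of Stein's
  equation for this chain with a \<open>1\<close>-Lipschitz right-hand side \<open>g\<close> again has increments at most
  \<open>1\<close>, so integration by parts gives
  \<open>E ((g - E g) exp (l g)) \<le> c (exp l - 1) E (exp (l g))\<close>. Integrating in \<open>l\<close>
  bounds the Laplace transform of \<open>g - E g\<close> by that of a centred Poisson variable of mean \<open>c\<close>.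
  The conjugate of \<open>l \<mapsto> c (exp l - 1 - l)\<close> is \<open>alpha c\<close>, so the Gibbs variational
  principle, applied to a \<open>g\<close> whose increments are the signs of the difference of the distribution
  functions, bounds the partial sums of \<open>\<Sum>k. \<bar>F\<^sub>\<mu> k - F\<^sub>\<nu> k\<bar>\<close>. The quantile coupling
  shows that \<open>W1\<close> is at most the full sum.
\<close>

section \<open>Birth rates and Stein factors\<close>

text \<open>The birth rate that balances death rate \<open>k\<close>: for positive weights, the flow
  from \<open>k\<close> to \<open>k + 1\<close> equals the flow back. For a Poisson law it is
  constantly the mean.\<close>

definition birth_rate :: "nat pmf \<Rightarrow> nat \<Rightarrow> real" where
  "birth_rate p k = real (k + 1) * pmf p (k + 1) / pmf p k"

lemma expectation_pmf_atMost:
  "measure_pmf.expectation p (\<lambda>x. indicator {..k} x * s x) = (\<Sum>j\<le>k. pmf p j * s j)"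
  for p :: "nat pmf" and s :: "nat \<Rightarrow> real"
  by (subst integral_measure_pmf_real[of "{..k}"])
     (auto intro!: sum.cong simp: indicator_def)

lemma integrable_pmf_bounded:
  fixes h :: "'a \<Rightarrow> real"
  assumes "\<And>x. \<bar>h x\<bar> \<le> B"
  shows "integrable (measure_pmf p) h"
  by (rule measure_pmf.integrable_const_bound[where B = B]) (use assms in auto)

lemma integrable_pmf_indicator_mult:
  fixes h :: "'a \<Rightarrow> real"
  assumes "integrable (measure_pmf p) h"
  shows "integrable (measure_pmf p) (\<lambda>x. indicator A x * h x)"
  by (rule Bochner_Integration.integrable_bound[OF assms]) (auto simp: indicator_def)

text \<open>A decreasing indicator and an increasing function are negatively correlated. The factors
  \<open>?F - ?I x\<close> and \<open>s x - s k\<close> are both nonpositive up to \<open>k\<close>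
  and both nonnegative beyond it, so their product is nonnegative; in its expectation the
  \<open>s k\<close> terms cancel.\<close>

lemma chebyshev_pmf_atMost:
  fixes p :: "nat pmf" and s :: "nat \<Rightarrow> real"
  assumes s: "mono s" and int: "integrable (measure_pmf p) s"
  shows "(\<Sum>j\<le>k. pmf p j * s j) \<le> (\<Sum>j\<le>k. pmf p j) * measure_pmf.expectation p s"
proof -
  let ?F = "\<Sum>j\<le>k. pmf p j" and ?I = "indicat_real {..k}"
  have F: "?F = measure p {..k}"
    by (simp add: measure_measure_pmf_finite)
  have F01: "0 \<le> ?F" "?F \<le> 1"
    unfolding F by auto
  have intI: "integrable p (\<lambda>x. ?I x * s x)" "integrable p ?I"
    by (auto intro: integrable_pmf_indicator_mult[OF int] integrable_pmf_bounded[where B = 1])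
  have pw: "0 \<le> ?F * s x - ?F * s k + s k * ?I x - ?I x * s x" for x
  proof -
    have "0 \<le> (?F - ?I x) * (s x - s k)"
    proof (cases "x \<le> k")
      case True
      then show ?thesis
        using F01 s by (auto simp: mono_def intro!: mult_nonpos_nonpos)
    next
      case False
      then show ?thesis
        using F01 s by (auto simp: mono_def intro!: mult_nonneg_nonneg)
    qed
    then show ?thesis
      by (simp add: algebra_simps)
  qed
  have "0 \<le> measure_pmf.expectation p (\<lambda>x. ?F * s x - ?F * s k + s k * ?I x - ?I x * s x)"
    using pw by (intro integral_nonneg_AE AE_I2)
  moreover have "measure_pmf.expectation p ?I = ?F"
    using F by simp
  ultimately have "0 \<le> ?F * measure_pmf.expectation p s - ?F * s k + s k * ?F
      - measure_pmf.expectation p (\<lambda>x. ?I x * s x)"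
    using intI int by simp
  then show ?thesis
    unfolding expectation_pmf_atMost by (simp add: mult.commute)
qed

lemma birth_rate_nonneg: "birth_rate p k \<ge> 0"
  by (simp add: birth_rate_def)

lemma pmf_mult_birth_rate:
  assumes "\<And>k. pmf p k > 0"
  shows "pmf p k * birth_rate p k = real (k + 1) * pmf p (k + 1)"
  using assms[of k] by (simp add: birth_rate_def)

text \<open>Monotonicity bounds the rate by its value at \<open>0\<close>. Shifting the summation
  index and using detailed balance identifies the mean with the expected rate; doing this in
  \<open>ennreal\<close> yields integrability of the identity along the way.\<close>

lemma
  assumes pos: "\<And>k. pmf p k > 0" and anti: "antimono (birth_rate p)"
  shows integrable_birth_rate: "integrable (measure_pmf p) (birth_rate p)"
    and integrable_id_birth_rate: "integrable (measure_pmf p) real"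
    and expectation_birth_rate:
      "measure_pmf.expectation p (birth_rate p) = measure_pmf.expectation p real"
proof -
  have bd: "birth_rate p k \<le> birth_rate p 0" for k
    using anti by (auto simp: antimono_def)
  show int: "integrable (measure_pmf p) (birth_rate p)"
    using bd birth_rate_nonneg by (intro integrable_pmf_bounded[where B = "birth_rate p 0"]) auto
  have "(\<integral>\<^sup>+x. ennreal (real x) \<partial>p) = (\<Sum>k. ennreal (pmf p k) * ennreal (real k))"
    by (simp add: nn_integral_measure_pmf nn_integral_count_space_nat)
  also have "\<dots> = (\<Sum>k. ennreal (pmf p (Suc k)) * ennreal (real (Suc k)))"
    by (subst suminf_offset[where i = 1]) auto
  also have "\<dots> = (\<Sum>k. ennreal (pmf p k) * ennreal (birth_rate p k))"
    using pmf_mult_birth_rate[of p, OF pos]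
    by (intro arg_cong[where f = suminf] ext)
       (simp add: ennreal_mult' [symmetric] birth_rate_nonneg mult.commute del: of_nat_Suc)
  also have "\<dots> = (\<integral>\<^sup>+x. ennreal (birth_rate p x) \<partial>p)"
    by (simp add: nn_integral_measure_pmf nn_integral_count_space_nat)
  finally have eq: "(\<integral>\<^sup>+x. ennreal (real x) \<partial>p) = (\<integral>\<^sup>+x. ennreal (birth_rate p x) \<partial>p)" .
  also have "\<dots> = ennreal (measure_pmf.expectation p (birth_rate p))"
    using int birth_rate_nonneg by (intro nn_integral_eq_integral) auto
  finally show "integrable (measure_pmf p) real"
    by (intro integrableI_nn_integral_finite) auto
  show "measure_pmf.expectation p (birth_rate p) = measure_pmf.expectation p real"
    by (simp add: integral_eq_nn_integral birth_rate_nonneg eq)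
qed

text \<open>Detailed balance turns the term at \<open>j + 1\<close> into the birth term at
  \<open>j\<close>, so cutting at \<open>k\<close> loses exactly the birth term at
  \<open>k\<close>.\<close>

lemma sum_atMost_birth_rate:
  assumes "\<And>k. pmf p k > 0"
  shows "(\<Sum>j\<le>k. pmf p j * real j) = (\<Sum>j\<le>k. pmf p j * birth_rate p j) - pmf p k * birth_rate p k"
proof (induction k)
  case (Suc k)
  then show ?case
    using pmf_mult_birth_rate[of p k, OF assms] by (simp add: mult.commute)
qed simp

text \<open>Divided by \<open>pmf p k * birth_rate p k\<close>, the left side is up to sign the
  increment at \<open>k\<close> of the Stein solution for the identity, which is thus at most
  \<open>1\<close>. Chebyshev's inequality for the increasing function \<open>- birth_rate p\<close>
  leaves only the boundary term of the truncated sum.\<close>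

lemma stein_factor_id:
  assumes pos: "\<And>k. pmf p k > 0" and anti: "antimono (birth_rate p)"
  shows "(\<Sum>j\<le>k. pmf p j) * measure_pmf.expectation p real - (\<Sum>j\<le>k. pmf p j * real j)
         \<le> pmf p k * birth_rate p k"
proof -
  have "mono (\<lambda>x. - birth_rate p x)"
    using anti by (auto simp: mono_def antimono_def)
  from chebyshev_pmf_atMost[OF this, of p k] integrable_birth_rate[of p, OF assms]
  show ?thesis
    using sum_atMost_birth_rate[of p k, OF pos] expectation_birth_rate[of p, OF assms]
    by (simp add: sum_negf)
qed

text \<open>Comparison with the identity: \<open>real x - g x\<close> and \<open>real x + g x\<close> are both monotone, so
  Chebyshev's inequality applies to each.\<close>

lemma stein_factor_lipschitz:
  fixes g :: "nat \<Rightarrow> real"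
  assumes pos: "\<And>k. pmf p k > 0" and anti: "antimono (birth_rate p)"
    and lip: "\<And>k. \<bar>g (Suc k) - g k\<bar> \<le> 1" and int: "integrable (measure_pmf p) g"
  shows "\<bar>\<Sum>j\<le>k. pmf p j * (g j - measure_pmf.expectation p g)\<bar> \<le> pmf p k * birth_rate p k"
proof -
  note id = integrable_id_birth_rate[of p, OF pos anti] stein_factor_id[of p, OF pos anti, of k]
  have "mono (\<lambda>x. real x - g x)" "mono (\<lambda>x. real x + g x)"
    using lip by (auto simp: mono_iff_le_Suc abs_le_iff algebra_simps)
  note this[THEN chebyshev_pmf_atMost, of p k]
  then show ?thesis
    using id int
    by (simp add: abs_le_iff algebra_simps sum.distrib sum_subtractf sum_distrib_left)
qed

section \<open>Exponential tilting and the Laplace transform\<close>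

lemma abs_exp_diff_le:
  fixes a b l :: real
  assumes "l \<ge> 0" "\<bar>b - a\<bar> \<le> 1"
  shows "\<bar>exp (l * a) - exp (l * b)\<bar> \<le> (exp l - 1) * exp (l * a)"
proof -
  have e: "exp (l * (b - a)) \<le> exp l" "exp (- l) \<le> exp (l * (b - a))"
    using mult_left_mono[of "b - a" 1 l] mult_left_mono[of "-1" "b - a" l] assms by (auto simp: abs_le_iff)
  \<comment> \<open>The deviation of \<open>exp (l * (b - a))\<close> below \<open>1\<close> is no
    larger than the one above, because \<open>cosh l \<ge> 1\<close>.\<close>
  have "1 - exp (- l) \<le> exp l - 1"
    using cosh_real_ge_1[of l] by (simp add: cosh_def)
  with e have "\<bar>1 - exp (l * (b - a))\<bar> \<le> exp l - 1"
    by linarith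
  then have "\<bar>1 - exp (l * (b - a))\<bar> * exp (l * a) \<le> (exp l - 1) * exp (l * a)"
    by (rule mult_right_mono) simp
  moreover have "\<bar>1 - exp (l * (b - a))\<bar> * exp (l * a) = \<bar>(1 - exp (l * (b - a))) * exp (l * a)\<bar>"
    by (simp add: abs_mult)
  moreover have "(1 - exp (l * (b - a))) * exp (l * a) = exp (l * a) - exp (l * b)"
    by (simp add: left_diff_distrib right_diff_distrib flip: exp_add)
  ultimately show ?thesis
    by metis
qed

text \<open>Capping at \<open>n\<close> pushes \<open>p\<close> forward to a law on
  \<open>{..n}\<close> that \<open>h\<close> cannot tell from \<open>p\<close>.\<close>

lemma expectation_comp_min:
  fixes h :: "nat \<Rightarrow> real"
  assumes "\<And>x. h x = h (min x n)"
  shows "measure_pmf.expectation p h = (\<Sum>k\<le>n. pmf (map_pmf (\<lambda>x. min x n) p) k * h k)"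
proof -
  have "measure_pmf.expectation p h = measure_pmf.expectation (map_pmf (\<lambda>x. min x n) p) h"
    using assms by simp
  also have "\<dots> = (\<Sum>k\<le>n. pmf (map_pmf (\<lambda>x. min x n) p) k * h k)"
    by (subst integral_measure_pmf_real[of "{..n}"]) (auto simp: mult.commute)
  finally show ?thesis .
qed

text \<open>Abel summation: expanding the weight \<open>w\<close> in indicators of
  \<open>{..k}\<close> reduces expectations against \<open>w\<close> to the partial sums controlled
  by the Stein factors.\<close>

lemma telescope_eventually_const:
  fixes w :: "nat \<Rightarrow> real"
  assumes "w x = w (min x n)"
  shows "w x = w n + (\<Sum>k<n. (w k - w (Suc k)) * indicator {..k} x)"
proof -
  have "(\<Sum>k<n. (w k - w (Suc k)) * indicator {..k} x) = (\<Sum>k\<in>{min x n..<n}. w k - w (Suc k))"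
    by (rule sum.mono_neutral_cong_right) (auto simp: indicator_def)
  also have "\<dots> = w (min x n) - w n"
    using sum_Suc_diff'[of "min x n" n w] by (simp add: sum_subtractf)
  finally show ?thesis
    using assms by simp
qed

lemma integrable_comp_min:
  fixes h :: "nat \<Rightarrow> real"
  assumes "\<And>x. h x = h (min x n)"
  shows "integrable (measure_pmf p) h"
proof (rule integrable_pmf_bounded)
  show "\<bar>h x\<bar> \<le> (\<Sum>k\<le>n. \<bar>h k\<bar>)" for x
    by (subst assms) (rule member_le_sum, auto)
qed

lemma expectation_exp_tilt_le:
  fixes g :: "nat \<Rightarrow> real"
  assumes pos: "\<And>k. pmf p k > 0" and anti: "antimono (birth_rate p)"
    and lip: "\<And>k. \<bar>g (Suc k) - g k\<bar> \<le> 1" and const: "\<And>x. g x = g (min x n)" and l: "l \<ge> 0"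
  shows "measure_pmf.expectation p (\<lambda>x. (g x - measure_pmf.expectation p g) * exp (l * g x))
    \<le> birth_rate p 0 * (exp l - 1) * measure_pmf.expectation p (\<lambda>x. exp (l * g x))"
proof -
  define m where "m = measure_pmf.expectation p g"
  define w where "w = (\<lambda>x. exp (l * g x))"
  have w: "w x = w (min x n)" for x
    unfolding w_def by (subst const) simp
  have w_nonneg: "w x \<ge> 0" for x
    by (simp add: w_def)
  note int = integrable_comp_min[of g n p, OF const] integrable_comp_min[of w n p, OF w]
  have intg: "integrable p (\<lambda>x. g x - m)"
    using int by simp
  have bd: "birth_rate p k \<le> birth_rate p 0" for k
    using anti by (auto simp: antimono_def)
  have "(g x - m) * w x = w n * (g x - m) +
      (\<Sum>k<n. (w k - w (Suc k)) * (indicator {..k} x * (g x - m)))" for x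
    by (subst telescope_eventually_const[of w x n, OF w])
       (simp add: algebra_simps sum_distrib_left sum_distrib_right)
  then have "measure_pmf.expectation p (\<lambda>x. (g x - m) * w x) =
      measure_pmf.expectation p (\<lambda>x. w n * (g x - m) +
        (\<Sum>k<n. (w k - w (Suc k)) * (indicator {..k} x * (g x - m))))"
    by simp
  also have "\<dots> = w n * (measure_pmf.expectation p g - m) +
      (\<Sum>k<n. (w k - w (Suc k)) * (\<Sum>j\<le>k. pmf p j * (g j - m)))"
    using intg int(1) integrable_pmf_indicator_mult[OF intg]
    by (subst Bochner_Integration.integral_add)
       (auto simp: expectation_pmf_atMost Bochner_Integration.integral_sum)
  \<comment> \<open>Centring at the mean removes the boundary term with weight
    \<open>w n\<close>.\<close>
  also have "\<dots> = (\<Sum>k<n. (w k - w (Suc k)) * (\<Sum>j\<le>k. pmf p j * (g j - m)))"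
    by (simp add: m_def)
  also have "\<dots> \<le> (\<Sum>k<n. \<bar>w k - w (Suc k)\<bar> * \<bar>\<Sum>j\<le>k. pmf p j * (g j - m)\<bar>)"
    by (intro sum_mono) (simp flip: abs_mult)
  \<comment> \<open>The Stein factor supplies \<open>pmf p k\<close>, so that the sum over
    \<open>k\<close> becomes a truncated expectation of \<open>w\<close>; the rate is replaced by
    its maximum, at \<open>0\<close>.\<close>
  also have "\<dots> \<le> (\<Sum>k<n. ((exp l - 1) * w k) * (pmf p k * birth_rate p 0))"
  proof (intro sum_mono mult_mono)
    fix k
    show "\<bar>w k - w (Suc k)\<bar> \<le> (exp l - 1) * w k"
      unfolding w_def by (rule abs_exp_diff_le[OF l lip])
    show "\<bar>\<Sum>j\<le>k. pmf p j * (g j - m)\<bar> \<le> pmf p k * birth_rate p 0"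
      using stein_factor_lipschitz[of p g k, OF pos anti lip int(1)] mult_left_mono[OF bd[of k], of "pmf p k"]
      unfolding m_def by simp
  qed (use l in \<open>auto simp: w_def\<close>)
  also have "\<dots> = birth_rate p 0 * (exp l - 1) * (\<Sum>k<n. pmf p k * w k)"
    by (simp add: sum_distrib_left algebra_simps)
  also have "\<dots> \<le> birth_rate p 0 * (exp l - 1) * measure_pmf.expectation p w"
  proof (intro mult_left_mono)
    have "(\<Sum>k<n. pmf p k * w k) \<le> (\<Sum>k\<le>n. pmf p k * w k)"
      by (intro sum_mono2) (auto simp: w_def)
    also have "\<dots> = measure_pmf.expectation p (\<lambda>x. indicator {..n} x * w x)"
      by (simp add: expectation_pmf_atMost)
    also have "\<dots> \<le> measure_pmf.expectation p w"
      using int(2) by (intro integral_mono integrable_pmf_indicator_mult)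
        (auto simp: indicator_def w_nonneg)
    finally show "(\<Sum>k<n. pmf p k * w k) \<le> measure_pmf.expectation p w" .
  qed (use l in \<open>auto simp: birth_rate_nonneg\<close>)
  finally show ?thesis
    by (simp add: w_def m_def)
qed

text \<open>Since \<open>g\<close> is constant from \<open>n\<close> on, all expectations of functions of \<open>g\<close> are finite sums
  and no differentiation under an infinite sum is needed.\<close>

lemma expectation_exp_lipschitz_le:
  fixes g :: "nat \<Rightarrow> real"
  assumes pos: "\<And>k. pmf p k > 0" and anti: "antimono (birth_rate p)"
    and lip: "\<And>k. \<bar>g (Suc k) - g k\<bar> \<le> 1" and const: "\<And>x. g x = g (min x n)" and l: "l \<ge> 0"
  shows "measure_pmf.expectation p (\<lambda>x. exp (l * g x))
    \<le> exp (l * measure_pmf.expectation p g + birth_rate p 0 * (exp l - 1 - l))"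
proof -
  define m where "m = measure_pmf.expectation p g"
  define c where "c = birth_rate p 0"
  define q where "q = pmf (map_pmf (\<lambda>x. min x n) p)"
  define Z where "Z t = (\<Sum>k\<le>n. q k * exp (t * g k))" for t
  define Z' where "Z' t = (\<Sum>k\<le>n. q k * (g k * exp (t * g k)))" for t
  \<comment> \<open>\<open>R\<close> is the Laplace transform divided by the claimed bound, so the
    goal is \<open>R l \<le> 1\<close>. The tilting inequality says that its derivative is
    nonpositive for \<open>t \<ge> 0\<close>, and \<open>R 0 = 1\<close>.\<close>
  define R where "R t = Z t * exp (- (t * m + c * (exp t - 1 - t)))" for t
  have Z: "measure_pmf.expectation p (\<lambda>x. exp (t * g x)) = Z t" for t
    unfolding Z_def q_def by (rule expectation_comp_min) (subst const, simp)
  have Z': "measure_pmf.expectation p (\<lambda>x. (g x - m) * exp (t * g x)) = Z' t - m * Z t" for t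
  proof -
    have "measure_pmf.expectation p (\<lambda>x. (g x - m) * exp (t * g x)) =
        (\<Sum>k\<le>n. q k * ((g k - m) * exp (t * g k)))"
      unfolding q_def by (rule expectation_comp_min) (subst (1 2) const, simp)
    then show ?thesis
      by (simp add: Z_def Z'_def algebra_simps sum_subtractf sum_distrib_left)
  qed
  have dZ: "(Z has_real_derivative Z' t) (at t)" for t
    unfolding Z_def Z'_def by (auto intro!: derivative_eq_intros sum.cong)
  have dR: "(R has_real_derivative
      (Z' t - m * Z t - c * (exp t - 1) * Z t) * exp (- (t * m + c * (exp t - 1 - t)))) (at t)" for t
    unfolding R_def by (auto intro!: derivative_eq_intros dZ simp: algebra_simps)
  have "R l \<le> R 0"
  proof (rule DERIV_nonpos_imp_nonincreasing[OF l])
    fix t :: real assume "0 \<le> t"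
    then have "Z' t - m * Z t - c * (exp t - 1) * Z t \<le> 0"
      using expectation_exp_tilt_le[of p g n t, OF pos anti lip const] Z[of t] Z'[of t]
      by (simp add: m_def c_def)
    then show "\<exists>y. (R has_real_derivative y) (at t) \<and> y \<le> 0"
      using dR[of t] by (intro exI conjI) (assumption, auto intro: mult_nonpos_nonneg)
  qed
  also have "R 0 = 1"
    using Z[of 0] by (simp add: R_def)
  finally show ?thesis
    unfolding Z m_def[symmetric] c_def[symmetric]
    unfolding R_def exp_minus divide_inverse[symmetric] by (simp add: divide_le_eq)
qed

section \<open>Relative entropy and the Gibbs variational principle\<close>

lemma entropy_density_pmf:
  fixes p q :: "'a pmf"
  assumes ac: "absolutely_continuous (measure_pmf p) (measure_pmf q)" and x: "x \<in> set_pmf q"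
  shows "pmf p x > 0" "entropy_density (exp 1) p q x = ln (pmf q x / pmf p x)"
proof -
  have q: "pmf q x > 0"
    using x by (simp add: pmf_positive)
  show p: "pmf p x > 0"
  proof (rule ccontr)
    assume "\<not> pmf p x > 0"
    then have "pmf p x = 0"
      using pmf_nonneg[of p x] by linarith
    then have "{x} \<in> null_sets p"
      by (simp add: null_sets_def emeasure_pmf_single)
    then have "{x} \<in> null_sets q"
      using ac by (auto simp: absolutely_continuous_def)
    then show False
      using q by (simp add: null_sets_def emeasure_pmf_single)
  qed
  \<comment> \<open>Since \<open>{x}\<close> has positive \<open>p\<close>-mass, integrating over it
    determines the Radon-Nikodym derivative at the point \<open>x\<close> itself, not only almost
    everywhere.\<close>
  have "ennreal (pmf q x) = emeasure (density p (RN_deriv p q)) {x}"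
    using measure_pmf.density_RN_deriv[OF ac] by (simp add: emeasure_pmf_single)
  also have "\<dots> = RN_deriv p q x * ennreal (pmf p x)"
    by (simp add: emeasure_density emeasure_pmf_single)
  finally have "ennreal (pmf q x) = RN_deriv p q x * ennreal (pmf p x)" .
  from arg_cong[OF this, of enn2real] have "enn2real (RN_deriv p q x) = pmf q x / pmf p x"
    using p by (simp add: enn2real_mult)
  then show "entropy_density (exp 1) p q x = ln (pmf q x / pmf p x)"
    by (simp add: entropy_density_def log_def)
qed

text \<open>Change of measure from \<open>q\<close> to \<open>p\<close>. It is only an inequality
  because the mass of \<open>p\<close> outside the support of \<open>q\<close> is lost.\<close>

lemma nn_integral_pmf_ratio_le:
  fixes p q :: "'a pmf"
  assumes "\<And>x. 0 \<le> h x"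
  shows "(\<integral>\<^sup>+x. ennreal (pmf p x / pmf q x * h x) \<partial>q) \<le> (\<integral>\<^sup>+x. ennreal (h x) \<partial>p)"
  unfolding nn_integral_measure_pmf
  by (intro nn_integral_mono) (auto simp: assms simp flip: ennreal_mult')

text \<open>Jensen's inequality in the form \<open>ln t \<le> t - 1\<close>, applied to
  \<open>t = ?r x * exp (\<phi> x) / Z\<close>, whose \<open>q\<close>-expectation is at most
  \<open>1\<close>.\<close>

lemma gibbs_variational_le:
  fixes p q :: "'a pmf"
  assumes ac: "absolutely_continuous (measure_pmf p) (measure_pmf q)"
    and bdd: "\<And>x. \<bar>\<phi> x\<bar> \<le> B"
  shows "ereal (measure_pmf.expectation q \<phi> - ln (measure_pmf.expectation p (\<lambda>x. exp (\<phi> x))))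
    \<le> rel_entropy q p"
proof -
  let ?d = "entropy_density (exp 1) (measure_pmf p) (measure_pmf q)"
  let ?P = "\<integral>\<^sup>+x. ennreal (?d x) \<partial>q" and ?N = "\<integral>\<^sup>+x. ennreal (- ?d x) \<partial>q"
  let ?r = "\<lambda>x. pmf p x / pmf q x"
  define Z where "Z = measure_pmf.expectation p (\<lambda>x. exp (\<phi> x))"
  note d = entropy_density_pmf[OF ac]
  \<comment> \<open>A finite negative part rules out \<open>\<infinity> - \<infinity>\<close> in
    \<open>rel_entropy\<close>: either the entropy is \<open>\<infinity>\<close> or the entropy
    density is integrable.\<close>
  have "?N \<le> (\<integral>\<^sup>+x. ennreal (?r x * 1) \<partial>q)"
  proof (intro nn_integral_mono_AE AE_pmfI ennreal_leI)
    fix x assume x: "x \<in> set_pmf q"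
    have "- ?d x = ln (?r x)"
      using d[OF x] pmf_positive[OF x] by (simp add: ln_div)
    also have "\<dots> \<le> ?r x - 1"
      using d[OF x] pmf_positive[OF x] by (intro ln_le_minus_one) simp
    finally show "- ?d x \<le> ?r x * 1"
      by simp
  qed
  also have "\<dots> \<le> (\<integral>\<^sup>+x. ennreal 1 \<partial>p)"
    by (rule nn_integral_pmf_ratio_le) simp
  finally have N: "?N \<le> 1"
    by simp
  then have N': "?N \<noteq> \<infinity>"
    by (auto simp: top_unique)
  show ?thesis
  proof (cases "?P = \<infinity>")
    case True
    have "enn2ereal ?N \<noteq> \<infinity>"
      using N' by simp
    with True have "rel_entropy q p = \<infinity>"
      by (simp add: rel_entropy_def)
    then show ?thesis
      by simp
  next
    case False
    have intd: "integrable q ?d"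
      using False N' by (simp add: real_integrable_def)
    have int\<phi>: "integrable q \<phi>"
      using bdd by (rule integrable_pmf_bounded)
    have bdexp: "\<bar>exp (\<phi> x)\<bar> \<le> exp B" "exp (- B) \<le> exp (\<phi> x)" for x
      using bdd[of x] by auto
    have inte: "integrable p (\<lambda>x. exp (\<phi> x))"
      using bdexp(1) by (rule integrable_pmf_bounded)
    have "exp (- B) = measure_pmf.expectation p (\<lambda>x. exp (- B))"
      by simp
    also have "\<dots> \<le> Z"
      unfolding Z_def using inte bdexp(2) by (intro integral_mono) auto
    finally have Z: "Z > 0"
      using exp_gt_zero[of "- B"] by linarith
    have le: "(\<integral>\<^sup>+x. ennreal (?r x * exp (\<phi> x)) \<partial>q) \<le> ennreal Z"
      using nn_integral_pmf_ratio_le[where h = "\<lambda>x. exp (\<phi> x)" and p = p and q = q] nn_integral_eq_integral[OF inte]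
      by (simp add: Z_def)
    then have intr: "integrable q (\<lambda>x. ?r x * exp (\<phi> x))"
      by (intro integrableI_bounded) (auto simp: less_top[symmetric] top_unique intro: le_less_trans)
    have r_le: "measure_pmf.expectation q (\<lambda>x. ?r x * exp (\<phi> x)) \<le> Z"
      using le Z by (subst integral_eq_nn_integral) (auto intro: enn2real_leI)
    have "measure_pmf.expectation q (\<lambda>x. \<phi> x - ?d x - ln Z)
        \<le> measure_pmf.expectation q (\<lambda>x. ?r x * exp (\<phi> x) / Z - 1)"
    proof (rule integral_mono_AE)
      show "AE x in q. \<phi> x - ?d x - ln Z \<le> ?r x * exp (\<phi> x) / Z - 1"
      proof (rule AE_pmfI)
        fix x assume x: "x \<in> set_pmf q"
        have "\<phi> x - ?d x - ln Z = ln (?r x * exp (\<phi> x) / Z)"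
          using d[OF x] pmf_positive[OF x] Z by (simp add: ln_div ln_mult)
        also have "\<dots> \<le> ?r x * exp (\<phi> x) / Z - 1"
          using d[OF x] pmf_positive[OF x] Z by (intro ln_le_minus_one) simp
        finally show "\<phi> x - ?d x - ln Z \<le> ?r x * exp (\<phi> x) / Z - 1" .
      qed
    next
      show "integrable q (\<lambda>x. ?r x * exp (\<phi> x) / Z - 1)"
        by (intro Bochner_Integration.integrable_diff integrable_divide_zero intr) simp
    qed (use int\<phi> intd in auto)
    also have "\<dots> \<le> 0"
      using r_le Z
      by (subst Bochner_Integration.integral_diff[OF integrable_divide_zero[OF intr]]) (simp_all del: divide_divide_eq_left times_divide_eq_left)
    finally have "measure_pmf.expectation q \<phi> - ln Z \<le> measure_pmf.expectation q ?d"
      using int\<phi> intd by simp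
    then show ?thesis
      using rel_entropy_eq_KL_divergence[OF intd] by (simp add: Z_def KL_divergence_def)
  qed
qed

section \<open>The quantile coupling\<close>

text \<open>For \<open>u \<ge> 1\<close> the set under \<open>LEAST\<close> may be empty and the
  value arbitrary; only \<open>u < 1\<close> matters below.\<close>

definition quantile :: "nat pmf \<Rightarrow> real \<Rightarrow> nat" where
  "quantile p u = (LEAST k. u \<le> measure_pmf.prob p {..k})"

lemma quantile_le_iff:
  assumes "u < 1"
  shows "quantile p u \<le> k \<longleftrightarrow> u \<le> measure_pmf.prob p {..k}"
proof
  have "(\<lambda>k. measure_pmf.prob p {..k}) \<longlonglongrightarrow> measure_pmf.prob p (\<Union>k. {..k})"
    by (rule measure_pmf.finite_Lim_measure_incseq) (auto simp: incseq_def)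
  then have "(\<lambda>k. measure_pmf.prob p {..k}) \<longlonglongrightarrow> 1"
    by (simp add: UN_atMost_UNIV)
  then have "eventually (\<lambda>k. u < measure_pmf.prob p {..k}) sequentially"
    using assms by (rule order_tendstoD)
  then obtain n where "u \<le> measure_pmf.prob p {..n}"
    by (auto simp: eventually_sequentially intro: less_imp_le)
  then have "u \<le> measure_pmf.prob p {..quantile p u}"
    unfolding quantile_def by (rule LeastI)
  also assume "quantile p u \<le> k"
  then have "measure_pmf.prob p {..quantile p u} \<le> measure_pmf.prob p {..k}"
    by (intro measure_pmf.finite_measure_mono) auto
  finally show "u \<le> measure_pmf.prob p {..k}" .
next
  assume "u \<le> measure_pmf.prob p {..k}"
  then show "quantile p u \<le> k"
    unfolding quantile_def by (rule Least_le)
qed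

lemma measurable_quantile [measurable]: "quantile p \<in> measurable borel (count_space UNIV)"
  unfolding quantile_def by measurable

text \<open>A countable type has only countably many singletons of measure zero, so together they
  are null; this is the atomicity required of a pmf.\<close>

lemma (in prob_space) ex_pmf_distr:
  fixes X :: "'a \<Rightarrow> 'b :: countable"
  assumes X: "X \<in> measurable M (count_space UNIV)"
  shows "\<exists>p. measure_pmf p = distr M (count_space UNIV) X"
proof -
  let ?D = "distr M (count_space UNIV) X"
  interpret D: prob_space ?D
    using X by (rule prob_space_distr)
  have "AE x in ?D. \<forall>y. measure ?D {y} = 0 \<longrightarrow> x \<noteq> y"
  proof (subst AE_all_countable, rule allI)
    fix y
    show "AE x in ?D. measure ?D {y} = 0 \<longrightarrow> x \<noteq> y"
      by (cases "measure ?D {y} = 0")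
        (auto intro!: AE_I[of _ _ "{y}"] simp: D.emeasure_eq_measure)
  qed
  then have "AE x in ?D. measure ?D {x} \<noteq> 0"
    by eventually_elim auto
  then have "measure_pmf (Abs_pmf ?D) = ?D"
    using D.prob_space_axioms by (intro Abs_pmf_inverse) auto
  then show ?thesis ..
qed

lemma pmf_eqI_atMost:
  fixes p q :: "nat pmf"
  assumes "\<And>k. measure_pmf.prob p {..k} = measure_pmf.prob q {..k}"
  shows "p = q"
proof (rule pmf_eqI)
  fix k
  have "measure_pmf.prob r {..k} = (\<Sum>j\<le>k. pmf r j)" for r :: "nat pmf" and k
    by (simp add: measure_measure_pmf_finite)
  with assms have eq: "(\<Sum>j\<le>k. pmf p j) = (\<Sum>j\<le>k. pmf q j)" for k
    by simp
  show "pmf p k = pmf q k"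
    using eq[of k] eq[of "k - 1"] by (cases k) auto
qed

text \<open>Counting the levels \<open>k\<close> that separate \<open>x\<close> from
  \<open>y\<close> lets the transport cost be integrated level by level.\<close>

lemma ennreal_abs_diff_eq_suminf:
  "ennreal \<bar>real x - real y\<bar> = (\<Sum>k. indicator {min x y..<max x y} k)"
proof -
  have "(\<Sum>k. indicator {min x y..<max x y} k :: ennreal) =
      (\<Sum>k\<in>{min x y..<max x y}. indicator {min x y..<max x y} k)"
    by (rule suminf_finite) auto
  also have "\<dots> = ennreal (real (card {min x y..<max x y}))"
    by (simp add: ennreal_of_nat_eq_real_of_nat)
  also have "real (card {min x y..<max x y}) = \<bar>real x - real y\<bar>"
    by (auto simp: min_def max_def)
  finally show ?thesis ..
qed

text \<open>Both quantiles are evaluated at the same uniform \<open>u\<close>. Level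
  \<open>k\<close> separates them exactly when \<open>u\<close> lies between the two distribution
  functions at \<open>k\<close>, an interval of length equal to their difference.\<close>

lemma W1_le_suminf_cdf:
  "W1 p q \<le> (\<Sum>k. ennreal \<bar>measure_pmf.prob p {..k} - measure_pmf.prob q {..k}\<bar>)"
proof -
  let ?F = "\<lambda>r k. measure_pmf.prob r {..k::nat}"
  define U where "U = uniform_measure lborel {0<..<1::real}"
  interpret U: prob_space U
    unfolding U_def by (rule prob_space_uniform_measure) auto
  have sets_U [measurable_cong]: "sets U = sets borel"
    by (simp add: U_def)
  have AE_U: "AE u in U. u < 1"
    unfolding U_def by (rule AE_uniform_measureI) auto
  have em: "emeasure U A = emeasure lborel ({0<..<1} \<inter> A)" if "A \<in> sets borel" for A
    using that by (simp add: U_def divide_ennreal_def)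
  let ?X = "\<lambda>u. (quantile p u, quantile q u)"
  have X: "?X \<in> measurable U (count_space UNIV)"
  proof -
    have "?X \<in> measurable U (count_space UNIV \<Otimes>\<^sub>M count_space UNIV)"
      by measurable
    then show ?thesis
      by (simp add: pair_measure_countable)
  qed
  obtain c where c: "measure_pmf c = distr U (count_space UNIV) ?X"
    using U.ex_pmf_distr[OF X] by blast
  have cdf: "measure U {u \<in> space U. quantile r u \<le> k} = ?F r k" for r k
  proof -
    have "emeasure U {u \<in> space U. quantile r u \<le> k} = emeasure U {u \<in> space U. u \<le> ?F r k}"
      by (rule emeasure_eq_AE) (use AE_U in \<open>auto simp: quantile_le_iff\<close>)
    also have "\<dots> = emeasure lborel ({0<..<1} \<inter> {..?F r k})"
      by (subst em) (auto simp: U_def atMost_def)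
    \<comment> \<open>The endpoint \<open>?F r k\<close> belongs to the set only if it lies strictly
      inside the unit interval; either way it is a null set.\<close>
    also have "\<dots> = emeasure lborel ({0<..<?F r k} \<union> ({?F r k} \<inter> {0<..<1}))"
      by (rule arg_cong[where f = "emeasure lborel"]) (auto intro: less_le_trans[OF _ measure_pmf.prob_le_1])
    also have "\<dots> = emeasure lborel {0<..<?F r k}"
      by (intro emeasure_Un_null_set) (auto intro!: finite_imp_null_set_lborel)
    finally show ?thesis
      by (simp add: measure_def)
  qed
  have "map_pmf fst c = p"
  proof (rule pmf_eqI_atMost)
    fix k
    have "measure_pmf.prob (map_pmf fst c) {..k} = measure U {u \<in> space U. quantile p u \<le> k}"
      unfolding measure_map_pmf c using X
      by (subst measure_distr) (auto intro!: arg_cong[where f = "measure U"])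
    then show "measure_pmf.prob (map_pmf fst c) {..k} = ?F p k"
      by (simp add: cdf)
  qed
  moreover have "map_pmf snd c = q"
  proof (rule pmf_eqI_atMost)
    fix k
    have "measure_pmf.prob (map_pmf snd c) {..k} = measure U {u \<in> space U. quantile q u \<le> k}"
      unfolding measure_map_pmf c using X
      by (subst measure_distr) (auto intro!: arg_cong[where f = "measure U"])
    then show "measure_pmf.prob (map_pmf snd c) {..k} = ?F q k"
      by (simp add: cdf)
  qed
  ultimately have "c \<in> couplings p q"
    by (simp add: couplings_def)
  then have "W1 p q \<le> (\<integral>\<^sup>+(x, y). ennreal \<bar>real x - real y\<bar> \<partial>c)"
    unfolding W1_def by (rule INF_lower)
  also have "\<dots> = (\<integral>\<^sup>+u. ennreal \<bar>real (quantile p u) - real (quantile q u)\<bar> \<partial>U)"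
    unfolding c using X by (subst nn_integral_distr) auto
  also have "\<dots> = (\<integral>\<^sup>+u. (\<Sum>k. indicator {min (?F p k) (?F q k)<..max (?F p k) (?F q k)} u) \<partial>U)"
  proof (rule nn_integral_cong_AE, use AE_U in eventually_elim)
    fix u :: real assume u: "u < 1"
    have "k \<in> {min (quantile p u) (quantile q u)..<max (quantile p u) (quantile q u)} \<longleftrightarrow>
        u \<in> {min (?F p k) (?F q k)<..max (?F p k) (?F q k)}" for k
      using quantile_le_iff[OF u, of p k] quantile_le_iff[OF u, of q k] by auto
    then show "ennreal \<bar>real (quantile p u) - real (quantile q u)\<bar> =
        (\<Sum>k. indicator {min (?F p k) (?F q k)<..max (?F p k) (?F q k)} u)"
      unfolding ennreal_abs_diff_eq_suminf indicator_def by simp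
  qed
  also have "\<dots> = (\<Sum>k. emeasure U {min (?F p k) (?F q k)<..max (?F p k) (?F q k)})"
    by (subst nn_integral_suminf) auto
  also have "\<dots> \<le> (\<Sum>k. emeasure lborel {min (?F p k) (?F q k)<..max (?F p k) (?F q k)})"
  proof (intro suminf_le allI)
    show "emeasure U {a<..b} \<le> emeasure lborel {a<..b}" for a b
      unfolding em[OF greaterThanAtMost_borel] by (rule emeasure_mono) auto
  qed auto
  also have "\<dots> = (\<Sum>k. ennreal \<bar>?F p k - ?F q k\<bar>)"
    by (intro arg_cong[where f = suminf] ext) (auto simp: min_def max_def)
  finally show ?thesis .
qed

text \<open>Truncated Kantorovich potential of the pair.\<close>

definition cdf_test :: "nat pmf \<Rightarrow> nat pmf \<Rightarrow> nat \<Rightarrow> nat \<Rightarrow> real" where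
  "cdf_test p q n x =
    (\<Sum>k<n. sgn (measure_pmf.prob p {..k} - measure_pmf.prob q {..k}) * indicator {k<..} x)"

lemma cdf_test_min: "cdf_test p q n x = cdf_test p q n (min x n)"
  unfolding cdf_test_def by (intro sum.cong) (auto simp: indicator_def)

lemma cdf_test_lipschitz: "\<bar>cdf_test p q n (Suc x) - cdf_test p q n x\<bar> \<le> 1"
proof -
  let ?s = "\<lambda>k. sgn (measure_pmf.prob p {..k} - measure_pmf.prob q {..k})"
  have "cdf_test p q n (Suc x) - cdf_test p q n x = (\<Sum>k<n. if k = x then ?s k else 0)"
    unfolding cdf_test_def sum_subtractf[symmetric]
    by (intro sum.cong) (auto simp: indicator_def)
  also have "\<dots> = (if x < n then ?s x else 0)"
    by simp
  also have "\<bar>\<dots>\<bar> \<le> 1"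
    by (simp add: sgn_if)
  finally show ?thesis .
qed

lemma expectation_cdf_test:
  "measure_pmf.expectation r (cdf_test p q n) =
    (\<Sum>k<n. sgn (measure_pmf.prob p {..k} - measure_pmf.prob q {..k}) * (1 - measure_pmf.prob r {..k}))"
proof -
  have "measure_pmf.prob r {k<..} = 1 - measure_pmf.prob r {..k}" for k
    using measure_pmf.prob_compl[of "{..k}" r] by (simp add: Compl_eq_Diff_UNIV[symmetric] Compl_atMost)
  moreover have "integrable r (\<lambda>x. indicat_real {k<..} x)" for k
    by (rule integrable_pmf_bounded[where B = 1]) auto
  ultimately show ?thesis
    unfolding cdf_test_def by (subst Bochner_Integration.integral_sum) auto
qed

text \<open>Passing to tails reverses the sign of \<open>F\<^sub>p - F\<^sub>q\<close>, which is why
  the expectation under \<open>q\<close> comes first; the signs in the potential then produce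
  absolute values.\<close>

lemma expectation_cdf_test_diff:
  "measure_pmf.expectation q (cdf_test p q n) - measure_pmf.expectation p (cdf_test p q n) =
    (\<Sum>k<n. \<bar>measure_pmf.prob p {..k} - measure_pmf.prob q {..k}\<bar>)"
  unfolding expectation_cdf_test sum_subtractf[symmetric]
proof (intro sum.cong refl)
  fix k
  let ?a = "measure_pmf.prob p {..k}" and ?b = "measure_pmf.prob q {..k}"
  have "sgn (?a - ?b) * (1 - ?b) - sgn (?a - ?b) * (1 - ?a) = sgn (?a - ?b) * (?a - ?b)"
    by (simp add: algebra_simps)
  then show "sgn (?a - ?b) * (1 - ?b) - sgn (?a - ?b) * (1 - ?a) = \<bar>?a - ?b\<bar>"
    by (simp add: abs_sgn mult.commute)
qed

section \<open>Duality and the transport-entropy inequality\<close>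

text \<open>The Gibbs principle is used with \<open>l * g\<close>; the Laplace bound replaces
  \<open>ln Z\<close> by \<open>l\<close> times the \<open>p\<close>-mean of \<open>g\<close> plus
  the Poisson term, leaving the difference of the two means.\<close>

lemma rel_entropy_ge_cdf_distance:
  fixes p q :: "nat pmf"
  assumes pos: "\<And>k. pmf p k > 0" and anti: "antimono (birth_rate p)"
    and ac: "absolutely_continuous (measure_pmf p) (measure_pmf q)" and l: "l \<ge> 0"
  shows "ereal (l * (\<Sum>k<n. \<bar>measure_pmf.prob p {..k} - measure_pmf.prob q {..k}\<bar>)
      - birth_rate p 0 * (exp l - 1 - l)) \<le> rel_entropy q p"
proof -
  define g where "g = cdf_test p q n"
  have const: "g x = g (min x n)" for x
    unfolding g_def by (rule cdf_test_min)
  define Z where "Z = measure_pmf.expectation p (\<lambda>x. exp (l * g x))"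
  have bdd: "\<bar>l * g x\<bar> \<le> (\<Sum>k\<le>n. \<bar>l * g k\<bar>)" for x
    by (subst const) (rule member_le_sum, auto)
  have "Z \<le> exp (l * measure_pmf.expectation p g + birth_rate p 0 * (exp l - 1 - l))"
    unfolding Z_def
    by (rule expectation_exp_lipschitz_le[where n = n, OF pos anti])
      (auto simp: g_def cdf_test_lipschitz l intro: cdf_test_min)
  moreover have "Z > 0"
  proof -
    have "exp (- (\<Sum>k\<le>n. \<bar>l * g k\<bar>)) \<le> exp (l * g x)" for x
      using bdd[of x] by simp
    moreover have "integrable p (\<lambda>x. exp (l * g x))"
      by (rule integrable_comp_min[of _ n]) (subst const, simp)
    ultimately have "measure_pmf.expectation p (\<lambda>x. exp (- (\<Sum>k\<le>n. \<bar>l * g k\<bar>))) \<le> Z"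
      unfolding Z_def by (intro integral_mono) auto
    then show ?thesis
      using measure_pmf.prob_space[of p] by (simp add: less_le_trans[OF exp_gt_zero])
  qed
  ultimately have "ln Z \<le> l * measure_pmf.expectation p g + birth_rate p 0 * (exp l - 1 - l)"
    using ln_le_cancel_iff[of Z "exp (l * measure_pmf.expectation p g + birth_rate p 0 * (exp l - 1 - l))"]
    by simp
  moreover have "l * (\<Sum>k<n. \<bar>measure_pmf.prob p {..k} - measure_pmf.prob q {..k}\<bar>) =
      l * measure_pmf.expectation q g - l * measure_pmf.expectation p g"
    unfolding g_def expectation_cdf_test_diff[symmetric] by (simp add: algebra_simps)
  ultimately have "l * (\<Sum>k<n. \<bar>measure_pmf.prob p {..k} - measure_pmf.prob q {..k}\<bar>)
      - birth_rate p 0 * (exp l - 1 - l) \<le> measure_pmf.expectation q (\<lambda>x. l * g x) - ln Z"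
    by simp
  then have "ereal (l * (\<Sum>k<n. \<bar>measure_pmf.prob p {..k} - measure_pmf.prob q {..k}\<bar>)
      - birth_rate p 0 * (exp l - 1 - l)) \<le> ereal (measure_pmf.expectation q (\<lambda>x. l * g x) - ln Z)"
    by simp
  also have "\<dots> \<le> rel_entropy q p"
    unfolding Z_def by (rule gibbs_variational_le[OF ac bdd])
  finally show ?thesis .
qed

text \<open>This \<open>l\<close> solves \<open>r = c * (exp l - 1)\<close>, the critical point
  equation for maximising \<open>l * r - c * (exp l - 1 - l)\<close>.\<close>

lemma alpha_eq_legendre:
  assumes "c > 0" "r \<ge> 0"
  defines "l \<equiv> ln (1 + r / c)"
  shows "l \<ge> 0" "alpha c r = l * r - c * (exp l - 1 - l)"
proof -
  have "1 + r / c \<ge> 1"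
    using assms by simp
  then show "l \<ge> 0" "alpha c r = l * r - c * (exp l - 1 - l)"
    using assms(1) unfolding l_def alpha_def by (auto simp: field_simps)
qed

lemma alpha_W1_le_rel_entropy:
  fixes p q :: "nat pmf"
  assumes pos: "\<And>k. pmf p k > 0" and anti: "antimono (birth_rate p)"
    and ac: "absolutely_continuous (measure_pmf p) (measure_pmf q)"
  shows "ereal (alpha (birth_rate p 0) (enn2real (W1 q p))) \<le> rel_entropy q p"
proof -
  define c where "c = birth_rate p 0"
  define w where "w = enn2real (W1 q p)"
  define l where "l = ln (1 + w / c)"
  define K where "K = c * (exp l - 1 - l)"
  let ?D = "\<lambda>k. \<bar>measure_pmf.prob p {..k} - measure_pmf.prob q {..k}\<bar>"
  have c: "c > 0"
    using pos by (simp add: c_def birth_rate_def)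
  have w: "w \<ge> 0"
    by (simp add: w_def)
  note l = alpha_eq_legendre[OF c w, folded l_def]
  have H: "ereal (l * (\<Sum>k<n. ?D k) - K) \<le> rel_entropy q p" for n
    unfolding K_def c_def by (rule rel_entropy_ge_cdf_distance[OF pos anti ac l(1)])
  have "ereal (l * w - K) \<le> rel_entropy q p"
  \<comment> \<open>Entropy \<open>\<infinity>\<close> is trivial, and \<open>-\<infinity>\<close>
    contradicts \<open>H\<close> at \<open>n = 0\<close>.\<close>
  proof (cases "rel_entropy q p")
    case (real h)
    show ?thesis
    proof (cases "l = 0")
      case True
      then show ?thesis
        using H[of 0] by simp
    next
      case False
      then have "l > 0"
        using l by simp
      \<comment> \<open>With \<open>l\<close> fixed at the optimal value for \<open>w\<close>, this
        bound is uniform in \<open>n\<close> and passes to the whole series, hence to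
        \<open>W1\<close>. At \<open>n = 0\<close> it also shows that the bound is
        nonnegative.\<close>
      have h: "(\<Sum>k<n. ?D k) \<le> (h + K) / l" for n
        using H[of n] real \<open>l > 0\<close> by (simp add: field_simps)
      have "W1 q p \<le> (\<Sum>k. ennreal (?D k))"
        using W1_le_suminf_cdf[of q p] by (simp add: abs_minus_commute)
      also have "\<dots> = (SUP n. \<Sum>k<n. ennreal (?D k))"
        by (rule suminf_eq_SUP)
      also have "\<dots> \<le> ennreal ((h + K) / l)"
        using h by (intro SUP_least) (simp add: ennreal_leI)
      finally have "w \<le> (h + K) / l"
        unfolding w_def using h[of 0] by (intro enn2real_leI) simp_all
      then show ?thesis
        using real \<open>l > 0\<close> by (simp add: field_simps)
    qed
  qed (use H[of 0] in auto)
  then show ?thesis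
    using l(2) by (simp add: c_def w_def K_def)
qed

section \<open>Rates of ultra-log-concave measures\<close>

lemma birth_rate_poisson_density:
  assumes l: "l > 0" and d: "has_poisson_density p f l"
  shows "birth_rate p k = l * f (k + 1) / f k"
proof -
  have f: "f k > 0"
    using d by (simp add: has_poisson_density_def)
  have "pmf (poisson_pmf l) (k + 1) * real (k + 1) = l * pmf (poisson_pmf l) k"
    using l by (simp del: of_nat_Suc)
  moreover have "pmf (poisson_pmf l) k > 0"
    using l by simp
  ultimately show ?thesis
    using d f by (simp add: birth_rate_def has_poisson_density_def field_simps)
qed

text \<open>Log-concavity says that \<open>f (k + 1) / f k\<close> is nonincreasing. As
  \<open>birth_rate\<close> depends only on \<open>p\<close>, the pair \<open>l\<close>,
  \<open>f\<close> obtained here may differ from the \<open>T\<close>, \<open>f\<close> of the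
  theorem.\<close>

lemma ultra_log_concave_birth_rate_antimono:
  assumes "ultra_log_concave p"
  shows "antimono (birth_rate p)"
proof -
  obtain l f where l: "l > 0" and f: "log_concave_seq f" "has_poisson_density p f l"
    using assms by (auto simp: ultra_log_concave_def)
  have "birth_rate p (Suc k) \<le> birth_rate p k" for k
  proof -
    have "f k > 0" "f (Suc k) > 0" "f k * f (Suc (Suc k)) \<le> (f (Suc k))\<^sup>2"
      using f(1) by (auto simp: log_concave_seq_def dest: spec[of _ "Suc k"])
    then show ?thesis
      using l unfolding birth_rate_poisson_density[OF l f(2)]
      by (simp add: field_simps power2_eq_square)
  qed
  then show ?thesis
    by (simp add: antimono_iff_le_Suc)
qed

theorem theorem1p8:
  fixes T M :: real and f :: "nat \<Rightarrow> real" and \<mu> \<nu> :: "nat pmf"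
  assumes "T > 0"
    and "ultra_log_concave \<mu>"
    and "has_poisson_density \<mu> f T"
    and "M = f 1 / f 0"
    and "absolutely_continuous (measure_pmf \<mu>) (measure_pmf \<nu>)"
    and "finite_first_moment \<nu>"
  shows "ereal (alpha (T * M) (enn2real (W1 \<nu> \<mu>))) \<le> rel_entropy (measure_pmf \<nu>) (measure_pmf \<mu>)"
proof -
  have pos: "pmf \<mu> k > 0" for k
    using assms(1,3) by (simp add: has_poisson_density_def)
  have "birth_rate \<mu> 0 = T * M"
    using birth_rate_poisson_density[OF assms(1,3), of 0] assms(4) by simp
  then show ?thesis
    using alpha_W1_le_rel_entropy[OF pos ultra_log_concave_birth_rate_antimono[OF assms(2)] assms(5)]
    by simp
qed

end
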